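(* Let $M$ be an $\mathcal{R}_1$-injective special inverse monoid. Then every subgroup of $M$ has a finite index subgroup which embeds in the group of units of $M$.
   Context: An inverse monoid presentation $\langle X \mid R\rangle$ (with $X$, $R$ possibly infinite) defines the quotient of the free inverse monoid on $X$ by the congruence generated by $R$. The presentation is special if every defining relation has the form $r=1$ with $r$ a word over $X^{\pm1} = X \cup \{x^{-1} : x \in X\}$; an inverse monoid is special if it admits a special inverse monoid presentation. A subgroup of $M$ is a subsemigroup of $M$ which is a group (its identity element may be any idempotent of $M$). $\mathcal{R}_1$ denotes the Green's $\mathcal{R}$-class of the identity element $1$, that is, $\mathcal{R}_1=\{m\in M : mm^{-1}=1\}$. Let $\sigma$ be the least group congruence on $M$ ($s \mathrel{\sigma} t$ iff $es=et$ for some idempotent $e$); the maximal group image is $M/\sigma$. $M$ is called $\mathcal{R}_1$-injective if the natural morphism $M\to M/\sigma$ is injective when restricted to $\mathcal{R}_1$. The group of units is the group of all invertible elements of $M$, i.e. the $\mathcal{H}$-class of $1$. *)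

theory Defs
  imports "HOL-Algebra.Coset"
begin

section \<open>Congruences and quotients of monoids\<close>

definition monoid_congruence :: "('a, 'm) monoid_scheme \<Rightarrow> ('a \<times> 'a) set \<Rightarrow> bool" where
  "monoid_congruence M c \<longleftrightarrow> equiv (carrier M) c \<and>
     (\<forall>a a' b b'. (a, a') \<in> c \<longrightarrow> (b, b') \<in> c \<longrightarrow> (a \<otimes>\<^bsub>M\<^esub> b, a' \<otimes>\<^bsub>M\<^esub> b') \<in> c)"

definition generated_congruence ::
    "('a, 'm) monoid_scheme \<Rightarrow> ('a \<times> 'a) set \<Rightarrow> ('a \<times> 'a) set" where
  "generated_congruence M R = \<Inter> {c. monoid_congruence M c \<and> R \<subseteq> c}"

text \<open>The complex product of two congruence classes need not be a whole class (unlike for groups),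
  hence the saturation in the multiplication.\<close>

definition quotient_monoid :: "('a, 'm) monoid_scheme \<Rightarrow> ('a \<times> 'a) set \<Rightarrow> 'a set monoid" where
  "quotient_monoid M c =
     \<lparr>carrier = carrier M // c, mult = (\<lambda>A B. c `` (A <#>\<^bsub>M\<^esub> B)), one = c `` {\<one>\<^bsub>M\<^esub>}\<rparr>"

section \<open>Inverse monoids\<close>

locale inverse_monoid = monoid M for M (structure) +
  assumes ex1_inverse:
    "x \<in> carrier M \<Longrightarrow> \<exists>!y. y \<in> carrier M \<and> x \<otimes> y \<otimes> x = x \<and> y \<otimes> x \<otimes> y = y"

text \<open>Not to be confused with \<open>m_inv\<close>, which is the two-sided inverse of a unit.\<close>

definition iinv :: "('a, 'm) monoid_scheme \<Rightarrow> 'a \<Rightarrow> 'a" where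
  "iinv M x = (THE y. y \<in> carrier M \<and> x \<otimes>\<^bsub>M\<^esub> y \<otimes>\<^bsub>M\<^esub> x = x \<and> y \<otimes>\<^bsub>M\<^esub> x \<otimes>\<^bsub>M\<^esub> y = y)"

definition R1_class :: "('a, 'm) monoid_scheme \<Rightarrow> 'a set" where
  "R1_class M = {m \<in> carrier M. m \<otimes>\<^bsub>M\<^esub> iinv M m = \<one>\<^bsub>M\<^esub>}"

definition least_group_congruence :: "('a, 'm) monoid_scheme \<Rightarrow> ('a \<times> 'a) set" where
  "least_group_congruence M = \<Inter> {c. monoid_congruence M c \<and> group (quotient_monoid M c)}"

definition R1_injective :: "('a, 'm) monoid_scheme \<Rightarrow> bool" where
  "R1_injective M \<longleftrightarrow> inj_on (\<lambda>m. least_group_congruence M `` {m}) (R1_class M)"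

text \<open>\<open>H\<close> is a subgroup of the monoid \<open>M\<close> with identity \<open>e\<close>; here \<open>e\<close> may be any
  idempotent of \<open>M\<close>.\<close>

definition monoid_subgroup :: "('a, 'm) monoid_scheme \<Rightarrow> 'a set \<Rightarrow> 'a \<Rightarrow> bool" where
  "monoid_subgroup M H e \<longleftrightarrow> H \<subseteq> carrier M \<and> group (M\<lparr>carrier := H, one := e\<rparr>)"

section \<open>Inverse monoid presentations\<close>

text \<open>The letters \<open>(x, True)\<close> and \<open>(x, False)\<close> stand for \<open>x\<close> and \<open>x\<inverse>\<close>.\<close>

type_synonym 'x word = "('x \<times> bool) list"

definition words :: "'x set \<Rightarrow> 'x word set" where
  "words X = lists (X \<times> UNIV)"

definition word_inv :: "'x word \<Rightarrow> 'x word" where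
  "word_inv w = rev (map (\<lambda>(x, b). (x, \<not> b)) w)"

definition word_monoid :: "'x set \<Rightarrow> 'x word monoid" where
  "word_monoid X = \<lparr>carrier = words X, mult = (@), one = []\<rparr>"

text \<open>Wagner's description of the free inverse monoid as a quotient of the free monoid with
  involution.\<close>

definition wagner_congruence :: "'x set \<Rightarrow> ('x word \<times> 'x word) set" where
  "wagner_congruence X = generated_congruence (word_monoid X)
     ({(w @ word_inv w @ w, w) | w. w \<in> words X} \<union>
      {(u @ word_inv u @ w @ word_inv w, w @ word_inv w @ u @ word_inv u) | u w.
         u \<in> words X \<and> w \<in> words X})"

definition free_inverse_monoid :: "'x set \<Rightarrow> 'x word set monoid" where
  "free_inverse_monoid X = quotient_monoid (word_monoid X) (wagner_congruence X)"

definition presented_inverse_monoid ::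
    "'x set \<Rightarrow> ('x word \<times> 'x word) set \<Rightarrow> 'x word set set monoid" where
  "presented_inverse_monoid X R = quotient_monoid (free_inverse_monoid X)
     (generated_congruence (free_inverse_monoid X)
       {(wagner_congruence X `` {u}, wagner_congruence X `` {v}) | u v. (u, v) \<in> R})"

definition special_presentation :: "'x set \<Rightarrow> ('x word \<times> 'x word) set \<Rightarrow> bool" where
  "special_presentation X R \<longleftrightarrow> R \<subseteq> words X \<times> {[]}"

section \<open>The elementwise description of the least group congruence\<close>

lemma quotient_monoid_mult:
  assumes "monoid_congruence M c" "x \<in> carrier M" "y \<in> carrier M"
  shows "(c `` {x}) \<otimes>\<^bsub>quotient_monoid M c\<^esub> (c `` {y}) = c `` {x \<otimes>\<^bsub>M\<^esub> y}"
proof -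
  have eq: "equiv (carrier M) c"
    and comp: "\<And>a a' b b'. (a, a') \<in> c \<Longrightarrow> (b, b') \<in> c \<Longrightarrow> (a \<otimes>\<^bsub>M\<^esub> b, a' \<otimes>\<^bsub>M\<^esub> b') \<in> c"
    using assms(1) by (auto simp: monoid_congruence_def)
  have refl: "(x, x) \<in> c" "(y, y) \<in> c"
    using eq assms(2,3) by (auto simp: equiv_def refl_on_def)
  have trans: "(a, b) \<in> c \<Longrightarrow> (b, d) \<in> c \<Longrightarrow> (a, d) \<in> c" for a b d
    using eq by (auto simp: equiv_def elim: transE)
  have "c `` (c `` {x} <#>\<^bsub>M\<^esub> c `` {y}) = c `` {x \<otimes>\<^bsub>M\<^esub> y}"
  proof (intro equalityI subsetI)
    fix z assume "z \<in> c `` (c `` {x} <#>\<^bsub>M\<^esub> c `` {y})"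
    then obtain x' y' where "(x, x') \<in> c" "(y, y') \<in> c" "(x' \<otimes>\<^bsub>M\<^esub> y', z) \<in> c"
      by (auto simp: set_mult_def)
    then show "z \<in> c `` {x \<otimes>\<^bsub>M\<^esub> y}"
      using comp trans by blast
  next
    fix z assume "z \<in> c `` {x \<otimes>\<^bsub>M\<^esub> y}"
    then show "z \<in> c `` (c `` {x} <#>\<^bsub>M\<^esub> c `` {y})"
      using refl unfolding set_mult_def by blast
  qed
  then show ?thesis by (simp add: quotient_monoid_def)
qed

lemma (in monoid) group_quotient_monoid:
  assumes cong: "monoid_congruence G c"
    and inv: "\<And>x. x \<in> carrier G \<Longrightarrow> \<exists>y\<in>carrier G. (y \<otimes> x, \<one>) \<in> c"
  shows "group (quotient_monoid G c)"
proof -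
  note mult = quotient_monoid_mult[OF cong]
  have carr: "A \<in> carrier (quotient_monoid G c) \<longleftrightarrow> (\<exists>x\<in>carrier G. A = c `` {x})" for A
    by (auto simp: quotient_monoid_def quotient_def)
  have one: "\<one>\<^bsub>quotient_monoid G c\<^esub> = c `` {\<one>}" by (simp add: quotient_monoid_def)
  have eqc: "equiv (carrier G) c" using cong by (simp add: monoid_congruence_def)
  show ?thesis
  proof (rule groupI)
    fix A assume "A \<in> carrier (quotient_monoid G c)"
    then obtain x where x: "x \<in> carrier G" "A = c `` {x}" unfolding carr by blast
    obtain y where y: "y \<in> carrier G" "(y \<otimes> x, \<one>) \<in> c" using inv[OF x(1)] by blast
    have "(c `` {y}) \<otimes>\<^bsub>quotient_monoid G c\<^esub> A = \<one>\<^bsub>quotient_monoid G c\<^esub>"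
      using x y equiv_class_eq[OF eqc] by (simp add: mult one)
    then show "\<exists>B\<in>carrier (quotient_monoid G c).
        B \<otimes>\<^bsub>quotient_monoid G c\<^esub> A = \<one>\<^bsub>quotient_monoid G c\<^esub>"
      using y(1) by (intro bexI[of _ "c `` {y}"]) (auto simp only: carr)
  next
    fix A B D
    assume "A \<in> carrier (quotient_monoid G c)" "B \<in> carrier (quotient_monoid G c)"
    then obtain x y where xy: "x \<in> carrier G" "A = c `` {x}" "y \<in> carrier G" "B = c `` {y}"
      unfolding carr by blast
    show "A \<otimes>\<^bsub>quotient_monoid G c\<^esub> B \<in> carrier (quotient_monoid G c)"
      using xy by (simp only: mult carr) (blast intro: m_closed)
    assume "D \<in> carrier (quotient_monoid G c)"
    then obtain z where "z \<in> carrier G" "D = c `` {z}" unfolding carr by blast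
    with xy show "A \<otimes>\<^bsub>quotient_monoid G c\<^esub> B \<otimes>\<^bsub>quotient_monoid G c\<^esub> D =
        A \<otimes>\<^bsub>quotient_monoid G c\<^esub> (B \<otimes>\<^bsub>quotient_monoid G c\<^esub> D)"
      by (simp add: mult m_assoc)
  next
    show "\<one>\<^bsub>quotient_monoid G c\<^esub> \<in> carrier (quotient_monoid G c)"
      unfolding carr one by blast
    fix A assume "A \<in> carrier (quotient_monoid G c)"
    then show "\<one>\<^bsub>quotient_monoid G c\<^esub> \<otimes>\<^bsub>quotient_monoid G c\<^esub> A = A"
      unfolding carr by (auto simp only: one mult one_closed l_one)
  qed
qed

context inverse_monoid
begin

lemma inverse_unique:
  assumes "x \<in> carrier M" "y \<in> carrier M" "z \<in> carrier M"
    and "x \<otimes> y \<otimes> x = x" "y \<otimes> x \<otimes> y = y" "x \<otimes> z \<otimes> x = x" "z \<otimes> x \<otimes> z = z"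
  shows "y = z"
  using ex1_inverse[OF assms(1)] assms by blast

lemma iinv_props:
  assumes "x \<in> carrier M"
  shows "iinv M x \<in> carrier M" "x \<otimes> iinv M x \<otimes> x = x" "iinv M x \<otimes> x \<otimes> iinv M x = iinv M x"
  using theI'[OF ex1_inverse[OF assms]] unfolding iinv_def by auto

lemma idempotent_mult_idempotent:
  assumes [simp]: "e \<in> carrier M" "f \<in> carrier M" and e: "e \<otimes> e = e" and f: "f \<otimes> f = f"
  shows "(e \<otimes> f) \<otimes> (e \<otimes> f) = e \<otimes> f"
proof -
  define x where "x = iinv M (e \<otimes> f)"
  have [simp]: "x \<in> carrier M" and x1: "(e \<otimes> f) \<otimes> x \<otimes> (e \<otimes> f) = e \<otimes> f"
    and x2: "x \<otimes> (e \<otimes> f) \<otimes> x = x"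
    using iinv_props[of "e \<otimes> f"] by (auto simp: x_def)
  have ee: "e \<otimes> (e \<otimes> z) = e \<otimes> z" if "z \<in> carrier M" for z
    using that e by (simp flip: m_assoc)
  have ff: "f \<otimes> (f \<otimes> z) = f \<otimes> z" if "z \<in> carrier M" for z
    using that f by (simp flip: m_assoc)
  have x1': "e \<otimes> (f \<otimes> (x \<otimes> (e \<otimes> f))) = e \<otimes> f" using x1 by (simp add: m_assoc)
  have x2': "x \<otimes> (e \<otimes> (f \<otimes> x)) = x" using x2 by (simp add: m_assoc)
  have x2'': "x \<otimes> (e \<otimes> (f \<otimes> (x \<otimes> z))) = x \<otimes> z" if "z \<in> carrier M" for z
    using x2' that by (metis \<open>x \<in> carrier M\<close> assms(1,2) m_assoc m_closed)
  have y: "f \<otimes> x \<otimes> e = x"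
    by (rule inverse_unique[of "e \<otimes> f"]) (simp_all add: m_assoc ee ff x1' x2' x2'')
  have xx: "x \<otimes> x = x"
  proof -
    have "x \<otimes> x = (f \<otimes> x \<otimes> e) \<otimes> (f \<otimes> x \<otimes> e)" by (simp add: y)
    also have "\<dots> = f \<otimes> x \<otimes> e" by (simp add: m_assoc x2'')
    finally show ?thesis by (simp add: y)
  qed
  have "e \<otimes> f = x"
    by (rule inverse_unique[of x]) (use x1 x2 xx in simp_all)
  then show ?thesis using xx by simp
qed

lemma idempotents_commute:
  assumes [simp]: "e \<in> carrier M" "f \<in> carrier M" and e: "e \<otimes> e = e" and f: "f \<otimes> f = f"
  shows "e \<otimes> f = f \<otimes> e"
proof -
  have ee: "e \<otimes> (e \<otimes> z) = e \<otimes> z" if "z \<in> carrier M" for z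
    using that e by (simp flip: m_assoc)
  have ff: "f \<otimes> (f \<otimes> z) = f \<otimes> z" if "z \<in> carrier M" for z
    using that f by (simp flip: m_assoc)
  have 1: "e \<otimes> (f \<otimes> (e \<otimes> f)) = e \<otimes> f"
    using idempotent_mult_idempotent[of e f] e f by (simp add: m_assoc)
  have 2: "f \<otimes> (e \<otimes> (f \<otimes> e)) = f \<otimes> e"
    using idempotent_mult_idempotent[of f e] e f by (simp add: m_assoc)
  show ?thesis
    by (rule inverse_unique[of "e \<otimes> f"]) (simp_all add: m_assoc ee ff 1 2)
qed

lemma least_group_congruence_eq:
  "least_group_congruence M =
     {(s, t). s \<in> carrier M \<and> t \<in> carrier M \<and>
        (\<exists>e\<in>carrier M. e \<otimes> e = e \<and> e \<otimes> s = e \<otimes> t)}" (is "_ = ?S")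
proof
  have SI: "(s, t) \<in> ?S"
    if "s \<in> carrier M" "t \<in> carrier M" "e \<in> carrier M" "e \<otimes> e = e" "e \<otimes> s = e \<otimes> t" for s t e
    using that by blast
  have refl: "(s, s) \<in> ?S" if "s \<in> carrier M" for s
    using that by (auto intro!: bexI[of _ \<one>])
  have trans: "(s, v) \<in> ?S" if st: "(s, t) \<in> ?S" and tv: "(t, v) \<in> ?S" for s t v
  proof -
    from st obtain e where [simp]: "s \<in> carrier M" "t \<in> carrier M" "e \<in> carrier M"
      and e: "e \<otimes> e = e" "e \<otimes> s = e \<otimes> t" by blast
    from tv obtain f where [simp]: "v \<in> carrier M" "f \<in> carrier M"
      and f: "f \<otimes> f = f" "f \<otimes> t = f \<otimes> v" by blast
    have c: "e \<otimes> f = f \<otimes> e" using e f by (intro idempotents_commute) auto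
    have "(e \<otimes> f) \<otimes> s = (f \<otimes> e) \<otimes> s" using c by simp
    also have "\<dots> = f \<otimes> (e \<otimes> t)" using e by (simp add: m_assoc)
    also have "\<dots> = e \<otimes> (f \<otimes> t)" using c by (simp flip: m_assoc)
    also have "\<dots> = (e \<otimes> f) \<otimes> v" using f by (simp add: m_assoc)
    finally show ?thesis
      using idempotent_mult_idempotent[of e f] e f by (intro SI[of _ _ "e \<otimes> f"]) auto
  qed
  have left: "(u \<otimes> s, u \<otimes> t) \<in> ?S" if st: "(s, t) \<in> ?S" and [simp]: "u \<in> carrier M" for u s t
  proof -
    from st obtain e where [simp]: "s \<in> carrier M" "t \<in> carrier M" "e \<in> carrier M"
      and e: "e \<otimes> e = e" "e \<otimes> s = e \<otimes> t" by blast
    define u' where "u' = iinv M u"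
    have [simp]: "u' \<in> carrier M" and u: "u \<otimes> u' \<otimes> u = u" "u' \<otimes> u \<otimes> u' = u'"
      using iinv_props[of u] by (auto simp: u'_def)
    have i: "(u' \<otimes> u) \<otimes> (u' \<otimes> u) = u' \<otimes> u" using u by (simp flip: m_assoc)
    have c: "e \<otimes> (u' \<otimes> u) = (u' \<otimes> u) \<otimes> e"
      by (rule idempotents_commute) (use e i in auto)
    define g where "g = u \<otimes> e \<otimes> u'"
    have gu: "g \<otimes> u = u \<otimes> e"
    proof -
      have "g \<otimes> u = u \<otimes> (e \<otimes> (u' \<otimes> u))" by (simp add: g_def m_assoc)
      also have "\<dots> = u \<otimes> u' \<otimes> u \<otimes> e" unfolding c by (simp add: m_assoc)
      finally show ?thesis using u by simp
    qed
    have gc [simp]: "g \<in> carrier M" by (simp add: g_def)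
    have "g \<otimes> g = g \<otimes> u \<otimes> (e \<otimes> u')" by (simp add: g_def m_assoc)
    also have "\<dots> = u \<otimes> (e \<otimes> e) \<otimes> u'" unfolding gu by (simp add: m_assoc)
    finally have gg: "g \<otimes> g = g" using e by (simp add: g_def)
    have "g \<otimes> (u \<otimes> z) = u \<otimes> (e \<otimes> z)" if "z \<in> carrier M" for z
      using that gu by (metis \<open>e \<in> carrier M\<close> \<open>u \<in> carrier M\<close> gc m_assoc)
    then show ?thesis using e gg by (intro SI[of _ _ g]) auto
  qed
  have right: "(s \<otimes> u, t \<otimes> u) \<in> ?S" if st: "(s, t) \<in> ?S" and "u \<in> carrier M" for u s t
    using that by (auto simp flip: m_assoc intro!: SI)
  have cong: "monoid_congruence M ?S"
    unfolding monoid_congruence_def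
  proof (intro conjI allI impI)
    show "equiv (carrier M) ?S"
    proof (rule equivI)
      show "?S \<subseteq> carrier M \<times> carrier M" by blast
      show "refl_on (carrier M) ?S" using refl by (intro refl_onI)
      show "sym ?S" by (rule symI) force
      show "Relation.trans ?S" using trans by (intro transI)
    qed
    fix a a' b b' assume a: "(a, a') \<in> ?S" and b: "(b, b') \<in> ?S"
    show "(a \<otimes> b, a' \<otimes> b') \<in> ?S"
      by (rule trans[OF right[OF a] left[OF b]]) (use a b in auto)
  qed
  have "group (quotient_monoid M ?S)"
  proof (rule group_quotient_monoid[OF cong])
    fix s assume s: "s \<in> carrier M"
    have "(iinv M s \<otimes> s, \<one>) \<in> ?S"
      using iinv_props[OF s] s by (intro SI[of _ _ "iinv M s \<otimes> s"]) (simp_all flip: m_assoc)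
    with iinv_props(1)[OF s] show "\<exists>y\<in>carrier M. (y \<otimes> s, \<one>) \<in> ?S" by blast
  qed
  with cong show "least_group_congruence M \<subseteq> ?S"
    unfolding least_group_congruence_def by (intro Inter_lower CollectI conjI)
next
  show "?S \<subseteq> least_group_congruence M"
    unfolding least_group_congruence_def
  proof (intro Inter_greatest)
    fix c assume "c \<in> {c. monoid_congruence M c \<and> group (quotient_monoid M c)}"
    then have cong: "monoid_congruence M c" and "group (quotient_monoid M c)" by auto
    interpret Q: group "quotient_monoid M c" by fact
    note mult = quotient_monoid_mult[OF cong]
    have eqc: "equiv (carrier M) c" using cong by (simp add: monoid_congruence_def)
    have carr: "c `` {x} \<in> carrier (quotient_monoid M c)" if "x \<in> carrier M" for x
      using that by (auto simp: quotient_monoid_def quotient_def)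
    show "?S \<subseteq> c"
    proof clarify
      fix s t e assume [simp]: "s \<in> carrier M" "t \<in> carrier M" "e \<in> carrier M"
        and e: "e \<otimes> s = e \<otimes> t"
      have "c `` {e} \<otimes>\<^bsub>quotient_monoid M c\<^esub> c `` {s} =
            c `` {e} \<otimes>\<^bsub>quotient_monoid M c\<^esub> c `` {t}"
        by (simp add: mult e)
      then have "c `` {s} = c `` {t}" using Q.Units_l_cancel carr by (simp add: Q.Units_eq)
      then show "(s, t) \<in> c" using eq_equiv_class[OF _ eqc] by simp
    qed
  qed
qed

end

end

theory Submission
  imports Defs
begin

text \<open>
  Write \<open>R\<^sub>e = {m. m m\<inverse> = e}\<close> for the R-class of an idempotent \<open>e\<close>.  If \<open>p \<in> R\<^sub>e\<close>, then \<open>p R\<^sub>1\<close>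
  lies inside \<open>R\<^sub>e\<close>; call it the translate of the right units by \<open>p\<close>.

  The presentation being special forces \<open>R\<^sub>e\<close> to be a union of finitely many translates
  (\<open>R_class_finite_union\<close>).  Let \<open>e\<close> be the value of a word \<open>u\<close>, and let \<open>V\<close> be the union of the
  translates by \<open>e p\<close>, for \<open>p\<close> the value of a prefix of \<open>u\<close>.  Letters act on \<open>V\<close> by right
  multiplication, as partial injections.  A relator \<open>r\<close> has value \<open>1\<close>, so its prefixes are right
  units, and \<open>r\<close> can be read from every point of \<open>V\<close> without leaving \<open>V\<close>: it acts as the identity.
  Hence words that are equal in the monoid have the same action on \<open>V\<close>.  If \<open>m \<in> R\<^sub>e\<close> is the value of
  \<open>t\<close>, then \<open>t t\<inverse>\<close> and \<open>u u\<inverse>\<close> both have value \<open>e\<close>; the second fixes \<open>e\<close>, so the first is defined at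
  \<open>e\<close>, so \<open>t\<close> can be read from \<open>e\<close> inside \<open>V\<close>, and it ends at \<open>e m = m\<close>.  In the language of
  Schuetzenberger graphs, the graph of \<open>e\<close> is covered by the finite path labelled \<open>u\<close> together with
  images of the graph of \<open>1\<close> rooted at the vertices of that path.

  A subgroup \<open>H\<close> with identity \<open>e\<close> acts on \<open>R\<^sub>e\<close> from the left and permutes the translates in \<open>R\<^sub>e\<close>
  that are maximal under inclusion; there are finitely many of these.  The stabiliser \<open>K\<close> of a
  maximal translate \<open>p R\<^sub>1\<close> therefore has finite index in \<open>H\<close>.  For \<open>k \<in> K\<close> write \<open>k p = p x\<^sub>k\<close> with
  \<open>x\<^sub>k \<in> R\<^sub>1\<close>.  Injectivity on \<open>R\<^sub>1\<close> makes \<open>p\<close> left cancellable against right units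
  (\<open>R1_injective_cancel\<close>), so \<open>x\<^sub>k\<close> is unique, \<open>k \<mapsto> x\<^sub>k\<close> is multiplicative, and consequently \<open>x\<^sub>k\<close> is a
  unit.  It determines \<open>k = k p p\<inverse> = p x\<^sub>k p\<inverse>\<close>, so this map embeds \<open>K\<close> in the group of units
  (\<open>finite_index_subgroup_embeds_in_units\<close>).
\<close>

section \<open>Inverses and Green's R-classes in an inverse monoid\<close>

context inverse_monoid
begin

lemma iinv_closed [simp]: "x \<in> carrier M \<Longrightarrow> iinv M x \<in> carrier M"
  by (rule iinv_props(1))

lemma iinv_eqI:
  assumes "x \<in> carrier M" "y \<in> carrier M" "x \<otimes> y \<otimes> x = x" "y \<otimes> x \<otimes> y = y"
  shows "iinv M x = y"
  using inverse_unique[OF assms(1) iinv_props(1)[OF assms(1)] assms(2)] iinv_props[OF assms(1)] assms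
  by blast

lemma mult_iinv_idem:
  assumes "x \<in> carrier M"
  shows "(x \<otimes> iinv M x) \<otimes> (x \<otimes> iinv M x) = x \<otimes> iinv M x"
    and "(iinv M x \<otimes> x) \<otimes> (iinv M x \<otimes> x) = iinv M x \<otimes> x"
  using assms iinv_props[OF assms] by (simp_all flip: m_assoc)

lemma iinv_mult_commute:
  assumes [simp]: "x \<in> carrier M" "y \<in> carrier M"
  shows "iinv M x \<otimes> x \<otimes> (y \<otimes> iinv M y) = y \<otimes> iinv M y \<otimes> (iinv M x \<otimes> x)"
  by (rule idempotents_commute) (simp_all add: mult_iinv_idem)

lemma iinv_mult:
  assumes [simp]: "x \<in> carrier M" "y \<in> carrier M"
  shows "iinv M (x \<otimes> y) = iinv M y \<otimes> iinv M x"
proof (rule iinv_eqI)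
  let ?x = "iinv M x" and ?y = "iinv M y"
  have "x \<otimes> y \<otimes> (?y \<otimes> ?x) \<otimes> (x \<otimes> y) = x \<otimes> (y \<otimes> ?y \<otimes> (?x \<otimes> x)) \<otimes> y"
    by (simp add: m_assoc)
  also have "\<dots> = x \<otimes> (?x \<otimes> x \<otimes> (y \<otimes> ?y)) \<otimes> y" by (simp add: iinv_mult_commute)
  also have "\<dots> = (x \<otimes> ?x \<otimes> x) \<otimes> (y \<otimes> ?y \<otimes> y)" by (simp add: m_assoc)
  finally show "x \<otimes> y \<otimes> (?y \<otimes> ?x) \<otimes> (x \<otimes> y) = x \<otimes> y" by (simp add: iinv_props)
  have "?y \<otimes> ?x \<otimes> (x \<otimes> y) \<otimes> (?y \<otimes> ?x) = ?y \<otimes> (?x \<otimes> x \<otimes> (y \<otimes> ?y)) \<otimes> ?x"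
    by (simp add: m_assoc)
  also have "\<dots> = ?y \<otimes> (y \<otimes> ?y \<otimes> (?x \<otimes> x)) \<otimes> ?x" by (simp add: iinv_mult_commute)
  also have "\<dots> = (?y \<otimes> y \<otimes> ?y) \<otimes> (?x \<otimes> x \<otimes> ?x)" by (simp add: m_assoc)
  finally show "?y \<otimes> ?x \<otimes> (x \<otimes> y) \<otimes> (?y \<otimes> ?x) = ?y \<otimes> ?x" by (simp add: iinv_props)
qed simp_all

lemma iinv_idem: "e \<in> carrier M \<Longrightarrow> e \<otimes> e = e \<Longrightarrow> iinv M e = e"
  by (rule iinv_eqI) simp_all

definition R_class :: "'a \<Rightarrow> 'a set" where
  "R_class e = {m \<in> carrier M. m \<otimes> iinv M m = e}"

lemma R1_class_eq: "R1_class M = R_class \<one>"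
  by (simp add: R1_class_def R_class_def)

lemma R_class_closed: "v \<in> R_class e \<Longrightarrow> v \<in> carrier M"
  by (simp add: R_class_def)

lemma right_unit_closed: "x \<in> R1_class M \<Longrightarrow> x \<in> carrier M"
  by (simp add: R1_class_def)

lemma one_right_unit: "\<one> \<in> R1_class M"
  by (simp add: R1_class_def iinv_idem)

lemma right_unitI:
  assumes [simp]: "x \<in> carrier M" "y \<in> carrier M" and xy: "x \<otimes> y = \<one>"
  shows "x \<in> R1_class M"
proof -
  have "x \<otimes> iinv M x = x \<otimes> iinv M x \<otimes> (x \<otimes> y)" using xy by simp
  also have "\<dots> = x \<otimes> iinv M x \<otimes> x \<otimes> y" by (simp add: m_assoc)
  also have "\<dots> = \<one>" using xy by (simp add: iinv_props)
  finally show ?thesis by (simp add: R1_class_def)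
qed

lemma idem_mult_R_class: "v \<in> R_class e \<Longrightarrow> e \<otimes> v = v"
  by (auto simp: R_class_def iinv_props)

lemma idem_in_R_class: "e \<in> carrier M \<Longrightarrow> e \<otimes> e = e \<Longrightarrow> e \<in> R_class e"
  by (simp add: R_class_def iinv_idem)

lemma R_class_mult_right_unit:
  assumes v: "v \<in> R_class e" and x: "x \<in> R1_class M"
  shows "v \<otimes> x \<in> R_class e"
proof -
  have [simp]: "v \<in> carrier M" "x \<in> carrier M"
    using v x by (auto intro: R_class_closed right_unit_closed)
  have "v \<otimes> x \<otimes> iinv M (v \<otimes> x) = v \<otimes> (x \<otimes> iinv M x) \<otimes> iinv M v"
    by (simp add: iinv_mult m_assoc)
  also have "\<dots> = v \<otimes> \<one> \<otimes> iinv M v" using x by (simp add: R1_class_def)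
  also have "\<dots> = e" using v by (simp add: R_class_def)
  finally show ?thesis by (simp add: R_class_def)
qed

lemma right_unit_mult: "x \<in> R1_class M \<Longrightarrow> y \<in> R1_class M \<Longrightarrow> x \<otimes> y \<in> R1_class M"
  using R_class_mult_right_unit by (simp add: R1_class_eq)

text \<open>This makes the edges of Schuetzenberger graphs reversible: the idempotent \<open>a a\<inverse>\<close> commutes past
  \<open>v\<inverse> v\<close>, which turns \<open>v a a\<inverse>\<close> into \<open>v a (v a)\<inverse> v = e v = v\<close>.\<close>

lemma R_class_mult_iinv:
  assumes v: "v \<in> R_class e" and va: "v \<otimes> a \<in> R_class e" and [simp]: "a \<in> carrier M"
  shows "v \<otimes> a \<otimes> iinv M a = v"
proof -
  have [simp]: "v \<in> carrier M" using v by (rule R_class_closed)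
  let ?v = "iinv M v" and ?a = "iinv M a"
  have "v \<otimes> a \<otimes> ?a = v \<otimes> (a \<otimes> ?a)" by (simp add: m_assoc)
  also have "\<dots> = v \<otimes> ?v \<otimes> v \<otimes> (a \<otimes> ?a)" by (simp add: iinv_props)
  also have "\<dots> = v \<otimes> (?v \<otimes> v \<otimes> (a \<otimes> ?a))" by (simp add: m_assoc)
  also have "\<dots> = v \<otimes> (a \<otimes> ?a \<otimes> (?v \<otimes> v))" by (simp add: iinv_mult_commute)
  also have "\<dots> = v \<otimes> a \<otimes> iinv M (v \<otimes> a) \<otimes> v" by (simp add: iinv_mult m_assoc)
  also have "\<dots> = e \<otimes> v" using va by (simp add: R_class_def)
  finally show ?thesis using v by (simp add: idem_mult_R_class)
qed

text \<open>The path from \<open>e\<close> labelled by a word with value \<open>p s\<close> never leaves the R-class of \<open>e\<close>, because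
  \<open>p p\<inverse>\<close> is above \<open>p s (p s)\<inverse>\<close> in the order of idempotents.\<close>

lemma idem_mult_prefix_in_R_class:
  assumes [simp]: "p \<in> carrier M" "s \<in> carrier M"
    and e: "e = p \<otimes> s \<otimes> iinv M (p \<otimes> s)"
  shows "e \<otimes> p \<in> R_class e"
proof -
  have [simp]: "e \<in> carrier M" using e by simp
  have ee: "e \<otimes> e = e" unfolding e by (rule mult_iinv_idem) simp
  have pe: "p \<otimes> iinv M p \<otimes> e = e"
  proof -
    have "p \<otimes> iinv M p \<otimes> e = (p \<otimes> iinv M p \<otimes> p) \<otimes> s \<otimes> iinv M (p \<otimes> s)"
      unfolding e by (simp add: m_assoc)
    then show ?thesis unfolding e by (simp add: iinv_props)
  qed
  have "e \<otimes> p \<otimes> iinv M (e \<otimes> p) = e \<otimes> (p \<otimes> iinv M p \<otimes> e)"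
    using ee by (simp add: iinv_mult iinv_idem m_assoc)
  then show ?thesis using ee by (simp add: pe R_class_def)
qed

text \<open>The idempotent \<open>p\<inverse> p\<close> identifies \<open>a\<close> and \<open>b\<close>, so they have the same image in the maximal group
  image.  Injectivity on the right units enters the argument in this form.\<close>

lemma R1_injective_cancel:
  assumes inj: "R1_injective M" and p [simp]: "p \<in> carrier M"
    and a: "a \<in> R1_class M" and b: "b \<in> R1_class M" and eq: "p \<otimes> a = p \<otimes> b"
  shows "a = b"
proof -
  let ?s = "least_group_congruence M"
  have [simp]: "a \<in> carrier M" "b \<in> carrier M"
    using a b by (auto intro: right_unit_closed)
  have "iinv M p \<otimes> p \<otimes> a = iinv M p \<otimes> p \<otimes> b" using eq by (simp add: m_assoc)
  then have ab: "(a, b) \<in> ?s"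
    unfolding least_group_congruence_eq using mult_iinv_idem(2)[OF p]
    by (auto intro!: bexI[of _ "iinv M p \<otimes> p"])
  have "sym ?s" "trans ?s"
    unfolding least_group_congruence_def
    by (auto simp: monoid_congruence_def intro!: sym_INTER[of _ id, simplified] trans_INTER[of _ id, simplified] elim: equivE)
  then have "?s `` {a} = ?s `` {b}" using ab by (blast dest: symD transD)
  then show ?thesis using inj a b by (auto simp: R1_injective_def dest: inj_onD)
qed

end

lemma word_inv_in_words: "w \<in> words X \<Longrightarrow> word_inv w \<in> words X"
  by (auto simp: words_def word_inv_def)

section \<open>Words acting on a graph with reversible deterministic edges\<close>

text \<open>Edges labelled \<open>(x, False)\<close> are the reversed edges labelled \<open>(x, True)\<close>, and determinism is asked
  for both kinds.  So each word acts as a partial injection, represented by its graph as a relation,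
  and composition of words becomes relational composition.\<close>

locale reversible_graph =
  fixes V :: "'v set" and E :: "'x \<times> bool \<Rightarrow> ('v \<times> 'v) set"
  assumes edges_subset: "E a \<subseteq> V \<times> V"
    and edges_converse: "E (x, \<not> b) = (E (x, b))\<inverse>"
    and edges_deterministic: "single_valued (E a)"
begin

fun walks :: "'x word \<Rightarrow> ('v \<times> 'v) set" where
  "walks [] = Id_on V"
| "walks (a # w) = E a O walks w"

lemma walks_subset: "walks w \<subseteq> V \<times> V"
  using edges_subset by (induction w) fastforce+

lemma walks_append: "walks (u @ w) = walks u O walks w"
proof (induction u)
  case Nil
  then show ?case using walks_subset[of w] by auto
qed (simp add: O_assoc)

lemma walks_word_inv: "walks (word_inv w) = (walks w)\<inverse>"
proof (induction w)
  case (Cons a w)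
  obtain x b where a: "a = (x, b)" by force
  have "word_inv (a # w) = word_inv w @ [(x, \<not> b)]" by (simp add: word_inv_def a)
  moreover have "walks [(x, \<not> b)] = (E a)\<inverse>"
    using edges_subset[of a] by (auto simp: a edges_converse)
  ultimately show ?case using Cons.IH by (simp only: walks_append converse_relcomp walks.simps)
qed (simp add: word_inv_def)

lemma walks_deterministic: "single_valued (walks w)"
  by (induction w) (simp_all add: single_valued_relcomp edges_deterministic single_valued_Id_on)

lemma walks_injective: "(x, z) \<in> walks w \<Longrightarrow> (y, z) \<in> walks w \<Longrightarrow> x = y"
  using walks_deterministic[of "word_inv w"] by (auto simp: walks_word_inv single_valued_def)

definition walk_kernel :: "'x set \<Rightarrow> ('x word \<times> 'x word) set" where
  "walk_kernel X = {(u, w). u \<in> words X \<and> w \<in> words X \<and> walks u = walks w}"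

lemma monoid_congruence_walk_kernel: "monoid_congruence (word_monoid X) (walk_kernel X)"
  unfolding monoid_congruence_def walk_kernel_def word_monoid_def
  by (auto simp: words_def walks_append intro!: equivI refl_onI symI transI)

text \<open>A partial injection \<open>f\<close> satisfies \<open>f f\<inverse> f = f\<close>, and \<open>f f\<inverse>\<close> is the identity on its domain; two
  such restricted identities commute.\<close>

lemma wagner_relations_in_walk_kernel:
  "{(w @ word_inv w @ w, w) | w. w \<in> words X} \<union>
   {(u @ word_inv u @ w @ word_inv w, w @ word_inv w @ u @ word_inv u) | u w.
      u \<in> words X \<and> w \<in> words X} \<subseteq> walk_kernel X"
proof -
  have idem: "walks (w @ word_inv w) = Id_on (Domain (walks w))" for w
    unfolding walks_append walks_word_inv by (auto dest: walks_injective)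
  have "Id_on (Domain A) O A = A" for A :: "('v \<times> 'v) set" by auto
  then have 1: "walks (w @ word_inv w @ w) = walks w" for w
    unfolding append_assoc[symmetric] walks_append[of "w @ word_inv w"] idem .
  have "Id_on A O Id_on B = Id_on B O Id_on A" for A B :: "'v set" by auto
  then have 2: "walks (u @ word_inv u @ w @ word_inv w) = walks (w @ word_inv w @ u @ word_inv u)"
    for u w
    using walks_append[of "u @ word_inv u" "w @ word_inv w"]
      walks_append[of "w @ word_inv w" "u @ word_inv u"] by (simp add: idem)
  have append: "u @ w \<in> words X" if "u \<in> words X" "w \<in> words X" for u w :: "'x word"
    using that by (simp add: words_def)
  show ?thesis
    unfolding walk_kernel_def using 1 2 by (auto simp: word_inv_in_words append)
qed

end

section \<open>Presented inverse monoids as quotients of the word monoid\<close>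

lemma monoid_congruence_generated:
  assumes "monoid M" "R \<subseteq> carrier M \<times> carrier M"
  shows "monoid_congruence M (generated_congruence M R)"
proof -
  interpret monoid M by fact
  let ?C = "{c. monoid_congruence M c \<and> R \<subseteq> c}"
  have "monoid_congruence M (carrier M \<times> carrier M)"
    unfolding monoid_congruence_def by (auto intro!: equivI refl_onI symI transI)
  then have sub: "\<Inter>?C \<subseteq> carrier M \<times> carrier M" using assms by blast
  have c: "equiv (carrier M) c" if "c \<in> ?C" for c
    using that by (simp add: monoid_congruence_def)
  have "equiv (carrier M) (\<Inter>?C)"
  proof (rule equivI)
    show "refl_on (carrier M) (\<Inter>?C)"
      using c by (auto intro!: refl_onI dest: equiv_class_self)
    show "sym (\<Inter>?C)" using c by (auto intro!: sym_INTER[of _ id, simplified] elim: equivE)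
    show "trans (\<Inter>?C)" using c by (auto intro!: trans_INTER[of _ id, simplified] elim: equivE)
  qed (rule sub)
  moreover have "(a \<otimes>\<^bsub>M\<^esub> b, a' \<otimes>\<^bsub>M\<^esub> b') \<in> \<Inter>?C"
    if "(a, a') \<in> \<Inter>?C" "(b, b') \<in> \<Inter>?C" for a a' b b'
    using that unfolding monoid_congruence_def by blast
  ultimately show ?thesis unfolding monoid_congruence_def generated_congruence_def by blast
qed

lemma generated_congruence_contains: "R \<subseteq> generated_congruence M R"
  by (auto simp: generated_congruence_def)

lemma generated_congruence_least:
  "monoid_congruence M c \<Longrightarrow> R \<subseteq> c \<Longrightarrow> generated_congruence M R \<subseteq> c"
  by (auto simp: generated_congruence_def)

lemma carrier_quotient_monoid:
  "A \<in> carrier (quotient_monoid M c) \<longleftrightarrow> (\<exists>x\<in>carrier M. A = c `` {x})"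
  by (auto simp: quotient_monoid_def quotient_def)

lemma one_quotient_monoid: "\<one>\<^bsub>quotient_monoid M c\<^esub> = c `` {\<one>\<^bsub>M\<^esub>}"
  by (simp add: quotient_monoid_def)

lemma monoid_quotient_monoid:
  assumes "monoid M" and cong: "monoid_congruence M c"
  shows "monoid (quotient_monoid M c)"
proof -
  interpret monoid M by fact
  note mult = quotient_monoid_mult[OF cong]
  show ?thesis
    by unfold_locales (auto simp: carrier_quotient_monoid mult one_quotient_monoid m_assoc)
qed

text \<open>Congruences above \<open>W\<close> descend to the quotient by \<open>W\<close>, and nothing is lost on the way.  With this,
  a congruence on words can be compared with one on the free inverse monoid.\<close>

lemma monoid_congruence_quotient:
  assumes W: "monoid_congruence M W" and c: "monoid_congruence M c" and Wc: "W \<subseteq> c"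
  shows "monoid_congruence (quotient_monoid M W) {(W `` {u}, W `` {v}) | u v. (u, v) \<in> c}"
    (is "monoid_congruence _ ?d")
    and "u \<in> carrier M \<Longrightarrow> v \<in> carrier M \<Longrightarrow>
      (W `` {u}, W `` {v}) \<in> {(W `` {u}, W `` {v}) | u v. (u, v) \<in> c} \<Longrightarrow> (u, v) \<in> c"
proof -
  have eW: "equiv (carrier M) W" and ec: "equiv (carrier M) c"
    and cm: "\<And>a a' b b'. (a, a') \<in> c \<Longrightarrow> (b, b') \<in> c \<Longrightarrow> (a \<otimes>\<^bsub>M\<^esub> b, a' \<otimes>\<^bsub>M\<^esub> b') \<in> c"
    using W c by (auto simp: monoid_congruence_def)
  have sub: "u \<in> carrier M \<and> v \<in> carrier M" if "(u, v) \<in> c" for u v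
    using ec that by (auto simp: equiv_def)
  have symc: "(v, u) \<in> c" if "(u, v) \<in> c" for u v
    using ec that by (auto simp: equiv_def dest: symD)
  have transc: "(u, w) \<in> c" if "(u, v) \<in> c" "(v, w) \<in> c" for u v w
    using ec that unfolding equiv_def by (meson transD)
  have class_carrier: "W `` {u} \<in> carrier (quotient_monoid M W)" if "u \<in> carrier M" for u
    using that by (auto simp: carrier_quotient_monoid)
  have reflc: "(u, u) \<in> c" if "u \<in> carrier M" for u
    using ec that by (auto simp: equiv_def dest: refl_onD)
  have Weq: "(u, v) \<in> c" if "W `` {u} = W `` {v}" "v \<in> carrier M" for u v
    using eq_equiv_class[OF that(1) eW that(2)] Wc by blast
  have reflect: "(u, v) \<in> c" if "u \<in> carrier M" "v \<in> carrier M" and d: "(W `` {u}, W `` {v}) \<in> ?d"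
    for u v
  proof -
    obtain u' v' where *: "W `` {u} = W `` {u'}" "W `` {v} = W `` {v'}" "(u', v') \<in> c"
      using d by blast
    have "(u, u') \<in> c" by (rule Weq[OF *(1)]) (use sub[OF *(3)] in simp)
    moreover have "(v', v) \<in> c" by (rule Weq[OF *(2)[symmetric] that(2)])
    ultimately show ?thesis using * transc by blast
  qed
  then show "u \<in> carrier M \<Longrightarrow> v \<in> carrier M \<Longrightarrow> (W `` {u}, W `` {v}) \<in> ?d \<Longrightarrow> (u, v) \<in> c" .
  note mult = quotient_monoid_mult[OF W]
  have "equiv (carrier (quotient_monoid M W)) ?d"
  proof (rule equivI)
    show "?d \<subseteq> carrier (quotient_monoid M W) \<times> carrier (quotient_monoid M W)"
      using sub class_carrier by blast
    show "refl_on (carrier (quotient_monoid M W)) ?d"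
      using reflc by (intro refl_onI) (auto simp: carrier_quotient_monoid)
    show "sym ?d" using symc by (intro symI) blast
    show "trans ?d"
    proof (rule transI)
      fix A B C assume "(A, B) \<in> ?d" "(B, C) \<in> ?d"
      then obtain u v v' w where *: "A = W `` {u}" "B = W `` {v}" "(u, v) \<in> c"
        "B = W `` {v'}" "C = W `` {w}" "(v', w) \<in> c" by blast
      have "(v, v') \<in> c" using Weq[OF trans[OF *(2)[symmetric] *(4)]] sub[OF *(6)] by blast
      then have "(u, w) \<in> c" using *(3,6) transc by blast
      then show "(A, C) \<in> ?d" using *(1,5) by blast
    qed
  qed
  moreover have "(A \<otimes>\<^bsub>quotient_monoid M W\<^esub> B, A' \<otimes>\<^bsub>quotient_monoid M W\<^esub> B') \<in> ?d"
    if AA: "(A, A') \<in> ?d" and BB: "(B, B') \<in> ?d" for A A' B B'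
  proof -
    obtain u v where A: "A = W `` {u}" "A' = W `` {v}" "(u, v) \<in> c" using AA by blast
    obtain s t where B: "B = W `` {s}" "B' = W `` {t}" "(s, t) \<in> c" using BB by blast
    have "A \<otimes>\<^bsub>quotient_monoid M W\<^esub> B = W `` {u \<otimes>\<^bsub>M\<^esub> s}"
      "A' \<otimes>\<^bsub>quotient_monoid M W\<^esub> B' = W `` {v \<otimes>\<^bsub>M\<^esub> t}"
      using A B sub[OF A(3)] sub[OF B(3)] by (simp_all add: mult)
    then show ?thesis using cm[OF A(3) B(3)] by blast
  qed
  ultimately show "monoid_congruence (quotient_monoid M W) ?d"
    unfolding monoid_congruence_def by blast
qed

lemma monoid_word_monoid: "monoid (word_monoid X)"
  by unfold_locales (auto simp: word_monoid_def words_def)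

lemma monoid_congruence_wagner: "monoid_congruence (word_monoid X) (wagner_congruence X)"
  unfolding wagner_congruence_def
  by (rule monoid_congruence_generated[OF monoid_word_monoid])
    (auto simp: word_monoid_def words_def word_inv_def)

text \<open>What a special presentation says about the evaluation \<open>\<theta>\<close> of words, without classes of classes:
  by \<open>\<theta>_universal\<close>, equality of values is forced by Wagner's relations and the relators, so any
  congruence on words that contains both can be used to tell elements of the monoid apart.\<close>

locale special_inverse_monoid = inverse_monoid M for M (structure) +
  fixes X :: "'x set" and R :: "('x word \<times> 'x word) set" and \<theta> :: "'x word \<Rightarrow> 'a"
  assumes \<theta>_closed: "w \<in> words X \<Longrightarrow> \<theta> w \<in> carrier M"
    and \<theta>_surj: "m \<in> carrier M \<Longrightarrow> \<exists>w\<in>words X. m = \<theta> w"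
    and \<theta>_append: "u \<in> words X \<Longrightarrow> w \<in> words X \<Longrightarrow> \<theta> (u @ w) = \<theta> u \<otimes> \<theta> w"
    and \<theta>_Nil: "\<theta> [] = \<one>"
    and \<theta>_word_inv: "w \<in> words X \<Longrightarrow> \<theta> (word_inv w) = iinv M (\<theta> w)"
    and relators: "(r, s) \<in> R \<Longrightarrow> r \<in> words X \<and> s = [] \<and> \<theta> r = \<one>"
    and \<theta>_universal: "\<And>c u w. monoid_congruence (word_monoid X) c \<Longrightarrow>
      wagner_congruence X \<subseteq> c \<Longrightarrow> R \<subseteq> c \<Longrightarrow> u \<in> words X \<Longrightarrow> w \<in> words X \<Longrightarrow> \<theta> u = \<theta> w \<Longrightarrow> (u, w) \<in> c"

lemma special_inverse_monoid_of_presentation: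
  fixes M :: "('a, 'm) monoid_scheme" (structure)
  assumes "inverse_monoid M" and sp: "special_presentation X R"
    and "M \<cong> presented_inverse_monoid X R"
  shows "\<exists>\<theta>. special_inverse_monoid M X R \<theta>"
proof -
  interpret inverse_monoid M by fact
  let ?W = "wagner_congruence X" and ?F = "free_inverse_monoid X"
  let ?gens = "{(?W `` {u}, ?W `` {v}) | u v. (u, v) \<in> R}"
  let ?S = "generated_congruence ?F ?gens"
  let ?P = "presented_inverse_monoid X R"
  define \<pi> where "\<pi> w = ?S `` {?W `` {w}}" for w
  have cw: "carrier (word_monoid X) = words X" "\<one>\<^bsub>word_monoid X\<^esub> = []"
    "u \<otimes>\<^bsub>word_monoid X\<^esub> w = u @ w" for u w :: "'b word"
    by (simp_all add: word_monoid_def)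
  have nil: "[] \<in> words X" by (simp add: words_def)
  have Rw: "r \<in> words X \<and> s = []" if "(r, s) \<in> R" for r s
    using sp that by (auto simp: special_presentation_def)
  note W = monoid_congruence_wagner[of X]
  have F: "monoid ?F"
    unfolding free_inverse_monoid_def by (rule monoid_quotient_monoid[OF monoid_word_monoid W])
  have carrF: "A \<in> carrier ?F \<longleftrightarrow> (\<exists>w\<in>words X. A = ?W `` {w})" for A
    by (simp add: free_inverse_monoid_def carrier_quotient_monoid cw)
  have WF: "?W `` {w} \<in> carrier ?F" if "w \<in> words X" for w
    using that carrF by blast
  have S: "monoid_congruence ?F ?S"
    by (rule monoid_congruence_generated[OF F]) (use WF Rw nil in auto)
  have carrP: "A \<in> carrier ?P \<longleftrightarrow> (\<exists>w\<in>words X. A = \<pi> w)" for A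
  proof -
    have "A \<in> carrier ?P \<longleftrightarrow> (\<exists>B\<in>carrier ?F. A = ?S `` {B})"
      unfolding presented_inverse_monoid_def by (rule carrier_quotient_monoid)
    moreover have "carrier ?F = (\<lambda>w. ?W `` {w}) ` words X" by (auto simp only: carrF)
    ultimately show ?thesis by (simp add: \<pi>_def)
  qed
  have \<pi>_append: "\<pi> (u @ w) = \<pi> u \<otimes>\<^bsub>?P\<^esub> \<pi> w" if "u \<in> words X" "w \<in> words X" for u w
  proof -
    have "?W `` {u @ w} = ?W `` {u} \<otimes>\<^bsub>?F\<^esub> ?W `` {w}"
      unfolding free_inverse_monoid_def using quotient_monoid_mult[OF W, of u w] that by (simp add: cw)
    moreover have "?W `` {u} \<in> carrier ?F" "?W `` {w} \<in> carrier ?F" using that carrF by blast+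
    ultimately show ?thesis
      unfolding presented_inverse_monoid_def \<pi>_def by (simp add: quotient_monoid_mult[OF S])
  qed
  have eW: "equiv (words X) ?W" using W by (simp add: monoid_congruence_def cw)
  have eS: "equiv (carrier ?F) ?S" using S by (simp add: monoid_congruence_def)
  have \<pi>_W: "\<pi> u = \<pi> w" if "(u, w) \<in> ?W" for u w
    using equiv_class_eq[OF eW that] by (simp add: \<pi>_def)
  have \<pi>_R: "\<pi> u = \<pi> w" if "(u, w) \<in> R" for u w
  proof -
    have "(?W `` {u}, ?W `` {w}) \<in> ?gens" using that by auto
    then have "(?W `` {u}, ?W `` {w}) \<in> ?S" by (rule subsetD[OF generated_congruence_contains])
    then show ?thesis unfolding \<pi>_def by (rule equiv_class_eq[OF eS])
  qed
  have \<pi>_universal: "(u, w) \<in> c"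
    if c: "monoid_congruence (word_monoid X) c" and Wc: "?W \<subseteq> c" and Rc: "R \<subseteq> c"
      and uw: "u \<in> words X" "w \<in> words X" and eq: "\<pi> u = \<pi> w" for c u w
  proof -
    let ?d = "{(?W `` {u}, ?W `` {v}) | u v. (u, v) \<in> c}"
    have "?S \<subseteq> ?d"
      by (rule generated_congruence_least)
        (use monoid_congruence_quotient(1)[OF W c Wc] Rc in \<open>auto simp: free_inverse_monoid_def\<close>)
    moreover have "(?W `` {u}, ?W `` {w}) \<in> ?S"
      using eq unfolding \<pi>_def by (rule eq_equiv_class[OF _ eS]) (rule WF[OF uw(2)])
    ultimately have "(?W `` {u}, ?W `` {w}) \<in> ?d" by (rule subsetD)
    then show ?thesis
      using monoid_congruence_quotient(2)[OF W c Wc, of u w] uw unfolding cw by simp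
  qed
  obtain i where i: "i \<in> hom M ?P" "bij_betw i (carrier M) (carrier ?P)"
    using assms(3) unfolding is_iso_def iso_def by blast
  define \<theta> where "\<theta> w = inv_into (carrier M) i (\<pi> w)" for w
  have iinj: "inj_on i (carrier M)" and isurj: "i ` carrier M = carrier ?P"
    using i(2) by (auto simp: bij_betw_def)
  have \<theta>c [simp]: "\<theta> w \<in> carrier M" and i\<theta>: "i (\<theta> w) = \<pi> w" if "w \<in> words X" for w
  proof -
    have "\<pi> w \<in> i ` carrier M" unfolding isurj carrP using that by blast
    then show "\<theta> w \<in> carrier M" "i (\<theta> w) = \<pi> w"
      unfolding \<theta>_def by (rule inv_into_into, rule f_inv_into_f)
  qed
  have app: "\<theta> (u @ w) = \<theta> u \<otimes> \<theta> w" if "u \<in> words X" "w \<in> words X" for u w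
  proof -
    have uw: "u @ w \<in> words X" using that by (simp add: words_def)
    have "i (\<theta> (u @ w)) = i (\<theta> u \<otimes> \<theta> w)"
      using that uw by (simp add: i\<theta> \<pi>_append hom_mult[OF i(1)])
    then show ?thesis using that uw by (intro inj_onD[OF iinj]) auto
  qed
  have surj: "\<exists>w\<in>words X. m = \<theta> w" if m: "m \<in> carrier M" for m
  proof -
    have "i m \<in> carrier ?P" using m isurj by blast
    then obtain w where w: "w \<in> words X" "i m = \<pi> w" unfolding carrP by blast
    then have "i m = i (\<theta> w)" by (simp add: i\<theta>)
    then show ?thesis using inj_onD[OF iinj] m w(1) \<theta>c by blast
  qed
  have one: "\<theta> [] = \<one>"
  proof -
    obtain w where w: "w \<in> words X" "\<one> = \<theta> w" using surj[OF one_closed] by blast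
    have "\<theta> [] = \<theta> [] \<otimes> \<theta> w" using nil by (simp flip: w(2))
    also have "\<dots> = \<theta> w" using app[OF nil w(1)] by simp
    finally show ?thesis using w by simp
  qed
  have winv: "\<theta> (word_inv w) = iinv M (\<theta> w)" if w: "w \<in> words X" for w
  proof -
    have w': "word_inv w \<in> words X" using w by (auto simp: words_def word_inv_def)
    have winv2: "word_inv (word_inv w) = w"
      by (induction w) (auto simp: word_inv_def rev_map)
    have appw: "u @ v \<in> words X" if "u \<in> words X" "v \<in> words X" for u v
      using that by (simp add: words_def)
    have regular: "\<theta> u \<otimes> \<theta> (word_inv u) \<otimes> \<theta> u = \<theta> u"
      if u: "u \<in> words X" "word_inv u \<in> words X" for u
    proof -
      have "(u @ word_inv u @ u, u) \<in> ?W"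
        unfolding wagner_congruence_def
        by (rule subsetD[OF generated_congruence_contains]) (use u(1) in auto)
      then have "\<pi> (u @ word_inv u @ u) = \<pi> u" by (rule \<pi>_W)
      then have "\<theta> (u @ word_inv u @ u) = \<theta> u" by (simp add: \<theta>_def)
      then show ?thesis using u by (simp add: app appw m_assoc)
    qed
    show ?thesis
      by (rule iinv_eqI[symmetric])
        (use w w' regular[OF w w'] regular[of "word_inv w"] in \<open>simp_all add: winv2\<close>)
  qed
  have "special_inverse_monoid M X R \<theta>"
  proof unfold_locales
    show "r \<in> words X \<and> s = [] \<and> \<theta> r = \<one>" if "(r, s) \<in> R" for r s
      using Rw[OF that] \<pi>_R[OF that] one by (simp add: \<theta>_def)
    show "(u, w) \<in> c" if "monoid_congruence (word_monoid X) c" "?W \<subseteq> c" "R \<subseteq> c"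
      "u \<in> words X" "w \<in> words X" "\<theta> u = \<theta> w" for c u w
      using \<pi>_universal[OF that(1-5)] i\<theta> that(4-6) by metis
  qed (use app surj one winv in auto)
  then show ?thesis by blast
qed

section \<open>Every R-class is a finite union of translates of the right units\<close>

context inverse_monoid
begin

definition translate :: "'a \<Rightarrow> 'a set" where
  "translate p = (\<lambda>x. p \<otimes> x) ` R1_class M"

lemma mem_translate: "p \<in> carrier M \<Longrightarrow> p \<in> translate p"
  unfolding translate_def using one_right_unit by (intro image_eqI[of _ _ \<one>]) auto

lemma translate_mono:
  assumes "p \<in> carrier M" "q \<in> translate p"
  shows "translate q \<subseteq> translate p"
proof -
  obtain x where x: "x \<in> R1_class M" "q = p \<otimes> x" using assms by (auto simp: translate_def)
  then have "q \<otimes> y = p \<otimes> (x \<otimes> y)" if "y \<in> R1_class M" for y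
    using that assms(1) x by (simp add: m_assoc right_unit_closed)
  then show ?thesis using x(1) right_unit_mult unfolding translate_def by auto
qed

end

context special_inverse_monoid
begin

lemma prefix_in_words: "u @ w \<in> words X \<longleftrightarrow> u \<in> words X \<and> w \<in> words X"
  by (auto simp: words_def)

text \<open>The set \<open>V\<close> below is a part of the Schuetzenberger graph of \<open>e\<close> that is already closed under
  reading relators.  The universal property of the presentation turns this into \<open>V\<close> being the
  whole R-class.\<close>

theorem R_class_finite_union:
  assumes [simp]: "e \<in> carrier M" and ee: "e \<otimes> e = e"
  shows "\<exists>P. finite P \<and> P \<subseteq> R_class e \<and> R_class e \<subseteq> (\<Union>p\<in>P. translate p)"
proof -
  obtain u where u: "u \<in> words X" "e = \<theta> u" using \<theta>_surj[of e] by auto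
  define P where "P = {e \<otimes> \<theta> (take k u) | k. k \<le> length u}"
  define V where "V = (\<Union>p\<in>P. translate p)"
  have uu: "e = \<theta> u \<otimes> iinv M (\<theta> u)" unfolding u(2)[symmetric] using ee by (simp add: iinv_idem)
  have fin: "finite P" unfolding P_def by simp
  have PR: "P \<subseteq> R_class e"
  proof
    fix p assume "p \<in> P"
    then obtain k where k: "p = e \<otimes> \<theta> (take k u)" by (auto simp: P_def)
    have w: "take k u \<in> words X" "drop k u \<in> words X"
      using u(1) prefix_in_words[of "take k u" "drop k u"] by auto
    have "\<theta> u = \<theta> (take k u) \<otimes> \<theta> (drop k u)" using \<theta>_append[OF w] by simp
    then show "p \<in> R_class e"
      unfolding k using uu w by (intro idem_mult_prefix_in_R_class) (auto simp: \<theta>_closed)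
  qed
  have VR: "V \<subseteq> R_class e"
    unfolding V_def translate_def using PR R_class_mult_right_unit by auto
  have Vunit: "v \<otimes> x \<in> V" if v: "v \<in> V" and x: "x \<in> R1_class M" for v x
  proof -
    obtain p where p: "p \<in> P" "v \<in> translate p" using v by (auto simp: V_def)
    have vc: "v \<in> carrier M" "p \<in> carrier M" using v VR p PR R_class_closed by auto
    have "v \<otimes> x \<in> translate v" using x by (auto simp: translate_def)
    then show ?thesis using translate_mono[OF vc(2) p(2)] p(1) by (auto simp: V_def)
  qed
  \<comment> \<open>Letters outside \<open>X\<close> have no edges: \<open>\<theta>\<close> is arbitrary on them, so reversibility could fail.\<close>
  define E where "E a =
    (if a \<in> X \<times> UNIV then {(v, v \<otimes> \<theta> [a]) | v. v \<in> V \<and> v \<otimes> \<theta> [a] \<in> V} else {})" for a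
  have letter: "[a] \<in> words X \<longleftrightarrow> a \<in> X \<times> UNIV" for a by (simp add: words_def)
  have Vc [simp]: "v \<in> carrier M" if "v \<in> V" for v using that VR R_class_closed by blast
  have rev: "(E (x, b))\<inverse> \<subseteq> E (x, \<not> b)" for x b
  proof (cases "x \<in> X")
    case True
    then have w: "[(x, b)] \<in> words X" by (simp add: letter)
    have "\<theta> [(x, \<not> b)] = iinv M (\<theta> [(x, b)])" using \<theta>_word_inv[OF w] by (simp add: word_inv_def)
    then show ?thesis
      using True R_class_mult_iinv[of _ e "\<theta> [(x, b)]"] VR \<theta>_closed[OF w] by (force simp: E_def)
  qed (simp add: E_def)
  interpret reversible_graph V E
  proof
    show "E a \<subseteq> V \<times> V" for a by (auto simp: E_def)
    show "E (x, \<not> b) = (E (x, b))\<inverse>" for x b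
      using rev[of x b] rev[of x "\<not> b"] by auto
    show "single_valued (E a)" for a by (auto simp: E_def single_valued_def)
  qed
  have walk_mult: "v' = v \<otimes> \<theta> w" if "w \<in> words X" "(v, v') \<in> walks w" for v v' w
    using that
  proof (induction w arbitrary: v)
    case (Cons a w)
    have aw: "[a] \<in> words X" "w \<in> words X" using Cons.prems(1) by (auto simp: words_def)
    obtain z where z: "(v, z) \<in> E a" "(z, v') \<in> walks w" using Cons.prems(2) by auto
    then have "v \<in> V" "z = v \<otimes> \<theta> [a]" by (auto simp: E_def split: if_splits)
    then show ?case
      using Cons.IH[OF aw(2) z(2)] \<theta>_append[OF aw] aw by (simp add: m_assoc \<theta>_closed)
  qed (auto simp: \<theta>_Nil)
  have walk_exists: "(v, v \<otimes> \<theta> w) \<in> walks w"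
    if "w \<in> words X" "v \<in> V" "\<And>k. k \<le> length w \<Longrightarrow> v \<otimes> \<theta> (take k w) \<in> V" for v w
    using that
  proof (induction w arbitrary: v)
    case Nil
    then show ?case by (auto simp: \<theta>_Nil)
  next
    case (Cons a w)
    have aw: "[a] \<in> words X" "w \<in> words X" using Cons.prems(1) by (auto simp: words_def)
    have split: "v \<otimes> \<theta> (a # s) = v \<otimes> \<theta> [a] \<otimes> \<theta> s" if "s \<in> words X" for s
      using \<theta>_append[OF aw(1) that] Cons.prems(2) aw that by (simp add: m_assoc \<theta>_closed)
    have va: "v \<otimes> \<theta> [a] \<in> V" using Cons.prems(3)[of "Suc 0"] by simp
    have "(v \<otimes> \<theta> [a], v \<otimes> \<theta> [a] \<otimes> \<theta> w) \<in> walks w"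
    proof (rule Cons.IH[OF aw(2) va])
      fix k assume "k \<le> length w"
      moreover have "take k w \<in> words X"
        using aw(2) prefix_in_words[of "take k w" "drop k w"] by simp
      ultimately show "v \<otimes> \<theta> [a] \<otimes> \<theta> (take k w) \<in> V"
        using Cons.prems(3)[of "Suc k"] by (simp add: split)
    qed
    moreover have "(v, v \<otimes> \<theta> [a]) \<in> E a"
      using va Cons.prems(2) aw(1) by (simp add: E_def letter)
    ultimately show ?case using split[OF aw(2)] by auto
  qed
  \<comment> \<open>This is where the presentation has to be special: relators act as the identity on \<open>V\<close>.\<close>
  have kernel_R: "R \<subseteq> walk_kernel X"
  proof clarify
    fix r s assume "(r, s) \<in> R"
    then have r: "r \<in> words X" "s = []" "\<theta> r = \<one>" using relators by auto
    have "(v, v) \<in> walks r" if v: "v \<in> V" for v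
    proof -
      \<comment> \<open>The rest of \<open>r\<close> provides a right inverse of each prefix.\<close>
      have "\<theta> (take k r) \<in> R1_class M" for k
      proof -
        have w: "take k r \<in> words X" "drop k r \<in> words X"
          using r(1) prefix_in_words[of "take k r" "drop k r"] by auto
        show ?thesis
          using \<theta>_append[OF w] r(3) w by (intro right_unitI[of _ "\<theta> (drop k r)"]) (auto simp: \<theta>_closed)
      qed
      then have "(v, v \<otimes> \<theta> r) \<in> walks r" using r(1) v Vunit by (intro walk_exists) auto
      then show ?thesis using v r(3) by simp
    qed
    moreover have "v' = v" "v \<in> V" if "(v, v') \<in> walks r" for v v'
      using walk_mult[OF r(1) that] walks_subset[of r] that r(3) by auto
    ultimately have "p \<in> walks r \<longleftrightarrow> p \<in> Id_on V" for p
      by (cases p) (simp add: Id_on_iff, metis)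
    then have "walks r = Id_on V" by blast
    then show "(r, s) \<in> walk_kernel X" using r by (simp add: walk_kernel_def words_def)
  qed
  have wagner: "wagner_congruence X \<subseteq> walk_kernel X"
    unfolding wagner_congruence_def
    by (intro generated_congruence_least monoid_congruence_walk_kernel wagner_relations_in_walk_kernel)
  have "R_class e \<subseteq> V"
  proof
    fix m assume m: "m \<in> R_class e"
    then obtain t where t: "t \<in> words X" "m = \<theta> t" using \<theta>_surj R_class_closed by blast
    have PV: "e \<otimes> \<theta> (take k u) \<in> V" if "k \<le> length u" for k
    proof -
      have p: "e \<otimes> \<theta> (take k u) \<in> P" using that by (auto simp: P_def)
      then have "e \<otimes> \<theta> (take k u) \<in> carrier M" using PR R_class_closed by blast
      then show ?thesis unfolding V_def using p mem_translate by blast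
    qed
    have eV: "e \<in> V" using PV[of 0] by (simp add: \<theta>_Nil)
    have "(e, e \<otimes> \<theta> u) \<in> walks u" by (rule walk_exists[OF u(1) eV PV])
    then have "(e, e) \<in> walks (u @ word_inv u)" by (auto simp: walks_append walks_word_inv)
    moreover have "(u @ word_inv u, t @ word_inv t) \<in> walk_kernel X"
    proof (rule \<theta>_universal[OF monoid_congruence_walk_kernel wagner kernel_R])
      show "\<theta> (u @ word_inv u) = \<theta> (t @ word_inv t)"
        using u t m uu by (simp add: \<theta>_append word_inv_in_words \<theta>_word_inv R_class_def)
    qed (use u t in \<open>auto simp: prefix_in_words word_inv_in_words\<close>)
    ultimately have "(e, e) \<in> walks (t @ word_inv t)" by (simp add: walk_kernel_def)
    then obtain v where v: "(e, v) \<in> walks t" by (auto simp: walks_append)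
    have "v = m" using walk_mult[OF t(1) v] t(2) idem_mult_R_class[OF m] by simp
    then show "m \<in> V" using v walks_subset by blast
  qed
  then show ?thesis using fin PR unfolding V_def by (intro exI[of _ P] conjI)
qed

end

section \<open>The action of a subgroup on its R-class\<close>

context inverse_monoid
begin

text \<open>\<open>K\<close> is the stabiliser of a maximal translate.  Translates are permuted by \<open>H\<close>, but a translate \<open>p R\<^sub>1\<close> with
  \<open>p \<in> P\<close> may be moved to one that is properly contained in some \<open>q R\<^sub>1\<close> with \<open>q \<in> P\<close> and is not itself
  in the list; choosing a maximal one keeps the orbit inside the finite list.\<close>

theorem finite_index_subgroup_embeds_in_units:
  assumes inj: "R1_injective M" and H: "monoid_subgroup M H e"
    and fin: "finite P" and PR: "P \<subseteq> R_class e" and cover: "R_class e \<subseteq> (\<Union>p\<in>P. translate p)"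
  shows "\<exists>K h. subgroup K (M\<lparr>carrier := H, one := e\<rparr>)
           \<and> finite (rcosets\<^bsub>M\<lparr>carrier := H, one := e\<rparr>\<^esub> K)
           \<and> h \<in> mon (M\<lparr>carrier := K, one := e\<rparr>) (units_of M)"
proof -
  define G where "G = M\<lparr>carrier := H, one := e\<rparr>"
  have G: "group G" and HM: "H \<subseteq> carrier M" using H by (auto simp: monoid_subgroup_def G_def)
  interpret G: group G by (rule G)
  have G_simps: "carrier G = H" "\<one>\<^bsub>G\<^esub> = e" "x \<otimes>\<^bsub>G\<^esub> y = x \<otimes> y" for x y
    by (simp_all add: G_def)
  have eH: "e \<in> H" and Hmult: "g \<in> H \<Longrightarrow> h \<in> H \<Longrightarrow> g \<otimes> h \<in> H"
    and He: "h \<in> H \<Longrightarrow> e \<otimes> h = h" "h \<in> H \<Longrightarrow> h \<otimes> e = h"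
    and Hinv: "h \<in> H \<Longrightarrow> inv\<^bsub>G\<^esub> h \<in> H"
    and Hl: "h \<in> H \<Longrightarrow> inv\<^bsub>G\<^esub> h \<otimes> h = e" and Hr: "h \<in> H \<Longrightarrow> h \<otimes> inv\<^bsub>G\<^esub> h = e" for g h
    using G.one_closed G.m_closed G.l_one G.r_one G.inv_closed G.l_inv G.r_inv
    unfolding G_simps by auto
  have Hc [simp]: "h \<in> carrier M" if "h \<in> H" for h using that HM by blast
  have Rc [simp]: "v \<in> carrier M" if "v \<in> R_class e" for v using that by (rule R_class_closed)
  have eR: "e \<in> R_class e" using eH He(1) by (intro idem_in_R_class) auto
  have Hact: "h \<otimes> v \<in> R_class e" if h: "h \<in> H" and v: "v \<in> R_class e" for h v
  proof -
    have "iinv M h = inv\<^bsub>G\<^esub> h"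
      using h Hinv[OF h] by (intro iinv_eqI) (simp_all add: Hl Hr He)
    moreover have "h \<otimes> v \<otimes> iinv M (h \<otimes> v) = h \<otimes> (v \<otimes> iinv M v) \<otimes> iinv M h"
      using h v by (simp add: iinv_mult m_assoc)
    moreover have "v \<otimes> iinv M v = e" using v by (simp only: R_class_def mem_Collect_eq)
    ultimately have "h \<otimes> v \<otimes> iinv M (h \<otimes> v) = e" using h by (simp add: He Hr)
    then show ?thesis using h v by (simp only: R_class_def mem_Collect_eq) simp
  qed
  have translate_act: "translate (h \<otimes> v) \<subseteq> translate (h \<otimes> w)"
    if "translate v \<subseteq> translate w" "h \<in> H" "v \<in> R_class e" "w \<in> R_class e" for h v w
  proof (rule translate_mono)
    show "h \<otimes> w \<in> carrier M" using that by simp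
    have "v \<in> translate w" using that mem_translate[of v] by auto
    then obtain x where "x \<in> R1_class M" "v = w \<otimes> x" by (auto simp: translate_def)
    then show "h \<otimes> v \<in> translate (h \<otimes> w)"
      using that(2,4) by (simp add: translate_def right_unit_closed flip: m_assoc)
  qed
  have translate_act_eq: "translate (h \<otimes> v) = translate (h \<otimes> w)"
    if "translate v = translate w" "h \<in> H" "v \<in> R_class e" "w \<in> R_class e" for h v w
    using that translate_act by (intro equalityI) auto
  have inv_act: "inv\<^bsub>G\<^esub> h \<otimes> (h \<otimes> v) = v" "h \<otimes> (inv\<^bsub>G\<^esub> h \<otimes> v) = v"
    if "h \<in> H" "v \<in> R_class e" for h v
    using that Hinv[of h] by (simp_all add: Hl Hr idem_mult_R_class flip: m_assoc)
  have below: "\<exists>q\<in>P. translate v \<subseteq> translate q" if v: "v \<in> R_class e" for v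
  proof -
    obtain q where "q \<in> P" "v \<in> translate q" using v cover by blast
    then show ?thesis using translate_mono PR by (meson R_class_closed subset_iff)
  qed
  \<comment> \<open>Every translate in the R-class lies below a member of the finite list, so \<open>p R\<^sub>1\<close> is maximal
    among all of them.\<close>
  have "P \<noteq> {}" using eR cover by auto
  then obtain p where p: "p \<in> P" and pmax: "\<And>q. q \<in> P \<Longrightarrow>
      translate p \<subseteq> translate q \<Longrightarrow> translate p = translate q"
    using finite_has_maximal[of "translate ` P"] fin by auto
  have pR: "p \<in> R_class e" using p PR by blast
  have orbit: "translate (h \<otimes> p) \<in> translate ` P" if h: "h \<in> H" for h
  proof -
    let ?h = "inv\<^bsub>G\<^esub> h"
    obtain q where q: "q \<in> P" "translate (h \<otimes> p) \<subseteq> translate q" using below Hact[OF h pR] by blast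
    have qR: "q \<in> R_class e" using q PR by blast
    obtain q' where q': "q' \<in> P" "translate (?h \<otimes> q) \<subseteq> translate q'"
      using below Hact[OF Hinv[OF h] qR] by blast
    have "translate p \<subseteq> translate (?h \<otimes> q)"
      using translate_act[OF q(2) Hinv[OF h] Hact[OF h pR] qR] inv_act(1)[OF h pR] by simp
    with q' pmax have "translate p = translate (?h \<otimes> q)" by (metis subset_antisym subset_trans)
    from translate_act_eq[OF this h pR Hact[OF Hinv[OF h] qR]]
    have "translate (h \<otimes> p) = translate q" using inv_act(2)[OF h qR] by simp
    then show ?thesis using q(1) by simp
  qed
  define K where "K = {h \<in> H. translate (h \<otimes> p) = translate p}"
  have KH: "K \<subseteq> H" by (auto simp: K_def)
  have Kinv: "inv\<^bsub>G\<^esub> h \<in> K" if "h \<in> K" for h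
    using that translate_act_eq[of "h \<otimes> p" p "inv\<^bsub>G\<^esub> h"] inv_act(1)[of h p] Hact[of h p] pR Hinv
    by (simp add: K_def)
  have Kmult: "g \<otimes> h \<in> K" if "g \<in> K" "h \<in> K" for g h
    using that translate_act_eq[of "h \<otimes> p" p g] Hact[of h p] pR Hmult by (simp add: K_def m_assoc)
  have sub: "subgroup K G"
    by (rule G.subgroupI)
      (use KH eH pR Kinv Kmult in \<open>auto simp: G_simps K_def idem_mult_R_class\<close>)
  \<comment> \<open>Right cosets of the stabiliser are the fibres of \<open>h \<mapsto> h\<inverse> p R\<^sub>1\<close>; the inverse turns the
    left action into a right one.\<close>
  define fibre where "fibre C = {h \<in> H. translate (inv\<^bsub>G\<^esub> h \<otimes> p) = C}" for C
  have coset: "K #>\<^bsub>G\<^esub> h = fibre (translate (inv\<^bsub>G\<^esub> h \<otimes> p))" if h: "h \<in> H" for h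
  proof -
    have "g \<in> K #>\<^bsub>G\<^esub> h \<longleftrightarrow> translate (inv\<^bsub>G\<^esub> g \<otimes> p) = translate (inv\<^bsub>G\<^esub> h \<otimes> p)"
      if g: "g \<in> H" for g
    proof -
      note g' = Hinv[OF g] and h' = Hinv[OF h]
      have hg: "h \<otimes> inv\<^bsub>G\<^esub> g \<in> H" using h g' Hmult by blast
      have a1: "h \<otimes> inv\<^bsub>G\<^esub> g \<otimes> p = h \<otimes> (inv\<^bsub>G\<^esub> g \<otimes> p)" using h g' pR by (simp add: m_assoc)
      have "g \<in> K #>\<^bsub>G\<^esub> h \<longleftrightarrow> h \<otimes> inv\<^bsub>G\<^esub> g \<in> K"
      proof
        assume "g \<in> K #>\<^bsub>G\<^esub> h"
        then obtain k where k: "k \<in> K" "g = k \<otimes>\<^bsub>G\<^esub> h" by (auto simp: r_coset_def)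
        have kG: "k \<in> carrier G" "h \<in> carrier G" using k h KH by (auto simp: G_simps)
        have "h \<otimes>\<^bsub>G\<^esub> inv\<^bsub>G\<^esub> g = inv\<^bsub>G\<^esub> k" unfolding k(2)
          using kG by (metis G.inv_equality G.inv_closed G.inv_inv G.inv_mult_group G.inv_solve_left' G.m_closed)
        then show "h \<otimes> inv\<^bsub>G\<^esub> g \<in> K" using Kinv k by (simp add: G_simps)
      next
        assume "h \<otimes> inv\<^bsub>G\<^esub> g \<in> K"
        then have "inv\<^bsub>G\<^esub> (h \<otimes>\<^bsub>G\<^esub> inv\<^bsub>G\<^esub> g) \<in> K" using Kinv by (simp add: G_simps)
        moreover have gG: "g \<in> carrier G" "h \<in> carrier G" using g h by (auto simp: G_simps)
        ultimately have "g \<otimes>\<^bsub>G\<^esub> inv\<^bsub>G\<^esub> h \<in> K" by (simp add: G.inv_mult_group)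
        moreover have "g = g \<otimes>\<^bsub>G\<^esub> inv\<^bsub>G\<^esub> h \<otimes>\<^bsub>G\<^esub> h" using gG by (simp add: G.m_assoc)
        ultimately show "g \<in> K #>\<^bsub>G\<^esub> h" by (auto simp: r_coset_def)
      qed
      also have "\<dots> \<longleftrightarrow> translate (h \<otimes> (inv\<^bsub>G\<^esub> g \<otimes> p)) = translate p"
        using hg by (simp add: K_def a1)
      also have "\<dots> \<longleftrightarrow> translate (inv\<^bsub>G\<^esub> g \<otimes> p) = translate (inv\<^bsub>G\<^esub> h \<otimes> p)"
        using translate_act_eq[of "h \<otimes> (inv\<^bsub>G\<^esub> g \<otimes> p)" p "inv\<^bsub>G\<^esub> h"]
          translate_act_eq[of "inv\<^bsub>G\<^esub> g \<otimes> p" "inv\<^bsub>G\<^esub> h \<otimes> p" h]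
          inv_act[OF h] Hact[OF g' pR] Hact[OF h' pR] Hact[OF h] h h' pR
        by (metis (no_types, lifting))
      finally show ?thesis .
    qed
    moreover have "K #>\<^bsub>G\<^esub> h \<subseteq> H"
      using KH h Hmult by (auto simp: r_coset_def G_simps)
    ultimately show ?thesis by (auto simp: fibre_def)
  qed
  have "rcosets\<^bsub>G\<^esub> K \<subseteq> fibre ` translate ` P"
    unfolding RCOSETS_def G_simps using coset orbit Hinv by auto
  then have finK: "finite (rcosets\<^bsub>G\<^esub> K)" using fin finite_subset by blast
  have cancel: "x = y" if "p \<otimes> x = p \<otimes> y" "x \<in> R1_class M" "y \<in> R1_class M" for x y
    using R1_injective_cancel[OF inj _ that(2,3,1)] pR by simp
  have ex: "\<exists>x. x \<in> R1_class M \<and> k \<otimes> p = p \<otimes> x" if "k \<in> K" for k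
  proof -
    have kR: "k \<otimes> p \<in> R_class e" using that KH Hact pR by blast
    then have "k \<otimes> p \<in> translate (k \<otimes> p)" by (intro mem_translate) simp
    then show ?thesis using that by (auto simp: K_def translate_def)
  qed
  then obtain x where xR: "\<And>k. k \<in> K \<Longrightarrow> x k \<in> R1_class M"
    and xp: "\<And>k. k \<in> K \<Longrightarrow> k \<otimes> p = p \<otimes> x k"
    by metis
  have xc: "x k \<in> carrier M" if "k \<in> K" for k using xR[OF that] by (rule right_unit_closed)
  have Kc [simp]: "k \<in> carrier M" if "k \<in> K" for k using that KH by auto
  have xhom: "x (g \<otimes> h) = x g \<otimes> x h" if g: "g \<in> K" and h: "h \<in> K" for g h
  proof (rule cancel)
    have "p \<otimes> x (g \<otimes> h) = g \<otimes> (h \<otimes> p)" using xp[OF Kmult[OF g h]] g h pR by (simp add: m_assoc)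
    also have "\<dots> = (g \<otimes> p) \<otimes> x h" using xp[OF h] xc[OF h] g pR by (simp add: m_assoc)
    also have "\<dots> = p \<otimes> (x g \<otimes> x h)" using xp[OF g] xc[OF g] xc[OF h] pR by (simp add: m_assoc)
    finally show "p \<otimes> x (g \<otimes> h) = p \<otimes> (x g \<otimes> x h)" .
  qed (use g h xR Kmult right_unit_mult in auto)
  have eK: "e \<in> K" using subgroup.one_closed[OF sub] by (simp add: G_simps)
  have xe: "x e = \<one>"
    by (rule cancel) (use eK xR xp[OF eK] idem_mult_R_class[OF pR] pR one_right_unit in auto)
  have xunit: "x k \<in> Units M" if k: "k \<in> K" for k
  proof -
    let ?k = "inv\<^bsub>G\<^esub> k"
    have "x k \<otimes> x ?k = \<one>" "x ?k \<otimes> x k = \<one>"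
      using xhom[OF k Kinv[OF k]] xhom[OF Kinv[OF k] k] xe Hl[of k] Hr[of k] k KH by auto
    then show ?thesis using xc[OF k] xc[OF Kinv[OF k]] by (auto simp: Units_def)
  qed
  \<comment> \<open>The element \<open>k\<close> is recovered as \<open>k p p\<inverse>\<close>, because \<open>p p\<inverse> = e\<close>.\<close>
  have xinj: "inj_on x K"
  proof (rule inj_onI)
    fix g h assume g: "g \<in> K" and h: "h \<in> K" and eq: "x g = x h"
    have pp: "p \<otimes> iinv M p = e" using pR by (simp only: R_class_def mem_Collect_eq)
    have "k \<otimes> p \<otimes> iinv M p = k" if "k \<in> K" for k
      using that pR KH He(2)[of k] pp by (auto simp: m_assoc)
    then show "g = h" using xp[OF g] xp[OF h] eq g h by metis
  qed
  have "x \<in> mon (M\<lparr>carrier := K, one := e\<rparr>) (units_of M)"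
    unfolding mon_def hom_def using xhom xunit xinj by (auto simp: units_of_def)
  then show ?thesis using sub finK unfolding G_def by blast
qed

end

theorem theorem5p1:
  fixes M :: "('a, 'm) monoid_scheme"
    and X :: "'x set" and R :: "('x word \<times> 'x word) set"
    and H :: "'a set" and e :: 'a
  assumes "inverse_monoid M"
    and "special_presentation X R"
    and "M \<cong> presented_inverse_monoid X R"
    and "R1_injective M"
    and "monoid_subgroup M H e"
  shows "\<exists>K h. subgroup K (M\<lparr>carrier := H, one := e\<rparr>)
           \<and> finite (rcosets\<^bsub>M\<lparr>carrier := H, one := e\<rparr>\<^esub> K)
           \<and> h \<in> mon (M\<lparr>carrier := K, one := e\<rparr>) (units_of M)"
proof -
  obtain \<theta> where "special_inverse_monoid M X R \<theta>"
    using special_inverse_monoid_of_presentation[OF assms(1-3)] by blast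
  then interpret special_inverse_monoid M X R \<theta> .
  interpret H: group "M\<lparr>carrier := H, one := e\<rparr>"
    using assms(5) by (simp add: monoid_subgroup_def)
  have "e \<in> carrier M" "e \<otimes>\<^bsub>M\<^esub> e = e"
    using H.one_closed H.l_one[OF H.one_closed] assms(5) by (auto simp: monoid_subgroup_def)
  from R_class_finite_union[OF this] obtain P where
    "finite P" "P \<subseteq> R_class e" "R_class e \<subseteq> (\<Union>p\<in>P. translate p)" by blast
  from finite_index_subgroup_embeds_in_units[OF assms(4,5) this] show ?thesis .
qed

end
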